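(* Let $N,M$ be integers with $1\le M\le N$ and let $0<p_0<p_1<1$. Let $\{X_n\}_{n=0}^\infty$ be the random walk on $\mathbb{Z}$ excited by its recent history with history window $N$, threshold $M$ and probabilities $p_0,p_1$. Then the speed $s(N,M;p_0,p_1):=\lim_{n\to\infty}\frac{X_n}{n}$ exists almost surely (as a deterministic constant) and is given by $$ s(N,M;p_0,p_1)=\frac{\frac1{1-p_0}\sum_{j=0}^{M-1}\left(\frac{2j}{N}-1\right)\binom Nj\left(\frac{p_0}{1-p_0}\right)^j+\frac1{1-p_1}\left(\frac{p_0}{1-p_0}\right)^M\sum_{j=M}^N\left(\frac{2j}{N}-1\right)\binom Nj\left(\frac{p_1}{1-p_1}\right)^{j-M}} {\frac1{1-p_0}\sum_{j=0}^{M-1}\binom Nj\left(\frac{p_0}{1-p_0}\right)^j+\frac1{1-p_1}\left(\frac{p_0}{1-p_0}\right)^M\sum_{j=M}^N\binom Nj\left(\frac{p_1}{1-p_1}\right)^{j-M}}. $$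
   Context: The process (random walk excited by its recent history, single threshold): $\{X_n\}_{n=0}^\infty$ takes values in $\mathbb{Z}$, starts from a fixed integer $X_0$, and at each step jumps by $+1$ (right) or $-1$ (left). Each of the first $N$ jumps is, independently, to the right with probability $p_0$ and to the left with probability $1-p_0$. At every subsequent step, conditionally on the whole past: if at least $M$ of the $N$ most recent jumps were to the right, the next jump is to the right with probability $p_1$ (and to the left with probability $1-p_1$); if fewer than $M$ of the $N$ most recent jumps were to the right, the next jump is to the right with probability $p_0$ (and to the left with probability $1-p_0$). *)

theory Defs
  imports "HOL-Probability.Probability"
begin

definition recent_right_jumps :: "nat \<Rightarrow> (nat \<Rightarrow> int) \<Rightarrow> nat \<Rightarrow> nat" where
  "recent_right_jumps N x n = card {k \<in> {n - N..<n}. x (Suc k) = x k + 1}"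

definition right_prob ::
  "nat \<Rightarrow> nat \<Rightarrow> real \<Rightarrow> real \<Rightarrow> (nat \<Rightarrow> int) \<Rightarrow> nat \<Rightarrow> real" where
  "right_prob N M p0 p1 x n = (if recent_right_jumps N x n \<ge> M then p1 else p0)"

text \<open>
  Since the process takes values in a countable set, conditioning on the whole past is
  expressed by elementary conditional probabilities given the trajectory up to time
  \<open>n\<close>; only the values \<open>x 0, \<dots>, x n\<close> of the reference path \<open>x\<close> matter. The positivity
  premises are needed because the library's conditional probability is \<open>0\<close> when the
  conditioning event is null.
\<close>
locale recent_history_walk = prob_space P for P :: "'a measure" +
  fixes N M :: nat and p0 p1 :: real and x0 :: int and X :: "nat \<Rightarrow> 'a \<Rightarrow> int"
  assumes random_variable_X: "X n \<in> measurable P (count_space UNIV)"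
    and start: "AE \<omega> in P. X 0 \<omega> = x0"
    and initial_indep:
      "indep_vars (\<lambda>_. count_space UNIV) (\<lambda>k \<omega>. X (Suc k) \<omega> - X k \<omega>) {..<N}"
    and initial_right: "k < N \<Longrightarrow> \<P>(\<omega> in P. X (Suc k) \<omega> = X k \<omega> + 1) = p0"
    and initial_left: "k < N \<Longrightarrow> \<P>(\<omega> in P. X (Suc k) \<omega> = X k \<omega> - 1) = 1 - p0"
    and later_right:
      "N \<le> n \<Longrightarrow> \<P>(\<omega> in P. \<forall>k\<le>n. X k \<omega> = x k) > 0 \<Longrightarrow>
        \<P>(\<omega> in P. X (Suc n) \<omega> = X n \<omega> + 1 \<bar> \<forall>k\<le>n. X k \<omega> = x k)
          = right_prob N M p0 p1 x n"
    and later_left: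
      "N \<le> n \<Longrightarrow> \<P>(\<omega> in P. \<forall>k\<le>n. X k \<omega> = x k) > 0 \<Longrightarrow>
        \<P>(\<omega> in P. X (Suc n) \<omega> = X n \<omega> - 1 \<bar> \<forall>k\<le>n. X k \<omega> = x k)
          = 1 - right_prob N M p0 p1 x n"

definition speed_formula :: "nat \<Rightarrow> nat \<Rightarrow> real \<Rightarrow> real \<Rightarrow> real" where
  "speed_formula N M p0 p1 =
    (1 / (1 - p0) * (\<Sum>j=0..M - 1. (2 * real j / real N - 1) * real (N choose j) * (p0 / (1 - p0)) ^ j)
      + 1 / (1 - p1) * (p0 / (1 - p0)) ^ M *
        (\<Sum>j=M..N. (2 * real j / real N - 1) * real (N choose j) * (p1 / (1 - p1)) ^ (j - M)))
    / (1 / (1 - p0) * (\<Sum>j=0..M - 1. real (N choose j) * (p0 / (1 - p0)) ^ j)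
      + 1 / (1 - p1) * (p0 / (1 - p0)) ^ M *
        (\<Sum>j=M..N. real (N choose j) * (p1 / (1 - p1)) ^ (j - M)))"

end

theory Submission
  imports Defs
begin

text \<open>The window of the last \<open>N\<close> jumps is a finite Markov chain whose stationary weight of a window
  depends only on its number \<open>j\<close> of right jumps; stationarity reduces to the one-step balance
  \<open>weight (j + 1) * (1 - q (j + 1)) = weight j * q j\<close>, where \<open>q j\<close> is the probability of a right
  jump. Let \<open>K\<close> be the transition operator. For every function \<open>f\<close> of the window, the
  increments \<open>f (W (k + 1)) - K f (W k)\<close> are bounded and uncorrelated, so their averages vanish
  almost surely; hence \<open>f\<close> and all iterates \<open>K^m f\<close> have the same time averages. By Doeblin's
  condition \<open>K^m f\<close> is uniformly close to the stationary mean of \<open>f\<close> for large \<open>m\<close>, so the time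
  averages of \<open>f\<close> converge to it. The speed is the case where \<open>f\<close> is the last jump.\<close>

section \<open>A strong law for bounded uncorrelated variables\<close>

text \<open>When the sum is squared, the cross terms with the new variable have mean zero, so each
  variable adds at most \<open>C^2\<close>.\<close>

lemma (in prob_space) bounded_uncorrelated_second_moment:
  fixes D :: "nat \<Rightarrow> 'a \<Rightarrow> real"
  assumes [measurable]: "\<And>k. D k \<in> borel_measurable M"
    and bound: "\<And>k \<omega>. \<bar>D k \<omega>\<bar> \<le> C"
    and uncorrelated: "\<And>j k. j < k \<Longrightarrow> expectation (\<lambda>\<omega>. D j \<omega> * D k \<omega>) = 0"
  shows "expectation (\<lambda>\<omega>. (\<Sum>k<n. D k \<omega>)\<^sup>2) \<le> real n * C\<^sup>2"
proof (induction n)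
  case (Suc n)
  have int2: "integrable M (\<lambda>\<omega>. D j \<omega> * D k \<omega>)" for j k
  proof (rule integrable_const_bound[where B = "C * C"])
    show "AE \<omega> in M. norm (D j \<omega> * D k \<omega>) \<le> C * C"
      using bound by (intro AE_I2) (auto simp: abs_mult intro!: mult_mono order_trans[OF abs_ge_zero bound])
  qed simp
  have sq: "(\<Sum>k<m. D k \<omega>)\<^sup>2 = (\<Sum>j<m. \<Sum>k<m. D j \<omega> * D k \<omega>)" for m \<omega>
    by (simp add: power2_eq_square sum_product)
  have "(\<Sum>k<Suc n. D k \<omega>)\<^sup>2 =
      (\<Sum>k<n. D k \<omega>)\<^sup>2 + 2 * (\<Sum>j<n. D j \<omega> * D n \<omega>) + D n \<omega> * D n \<omega>" for \<omega>
    by (simp add: power2_sum sum_distrib_right[symmetric] power2_eq_square[of "D n \<omega>"])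
  then have "expectation (\<lambda>\<omega>. (\<Sum>k<Suc n. D k \<omega>)\<^sup>2) =
      expectation (\<lambda>\<omega>. (\<Sum>k<n. D k \<omega>)\<^sup>2) + 2 * (\<Sum>j<n. expectation (\<lambda>\<omega>. D j \<omega> * D n \<omega>))
        + expectation (\<lambda>\<omega>. D n \<omega> * D n \<omega>)"
    using int2 by (simp add: sq)
  moreover have "(\<Sum>j<n. expectation (\<lambda>\<omega>. D j \<omega> * D n \<omega>)) = 0"
    by (intro sum.neutral ballI uncorrelated) simp
  moreover have "expectation (\<lambda>\<omega>. D n \<omega> * D n \<omega>) \<le> C\<^sup>2"
  proof (rule integral_le_const[OF int2])
    show "AE \<omega> in M. D n \<omega> * D n \<omega> \<le> C\<^sup>2"
      using bound by (intro AE_I2) (metis abs_le_square_iff abs_ge_zero abs_of_nonneg order_trans power2_eq_square)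
  qed
  ultimately show ?case
    using Suc by (simp add: algebra_simps)
qed simp

lemma filterlim_floor_sqrt_at_top: "filterlim floor_sqrt at_top sequentially"
  unfolding filterlim_at_top eventually_sequentially
  by (metis le_floor_sqrt_iff)

text \<open>With \<open>m = floor_sqrt n\<close>, at most \<open>2 * m\<close> terms lie between
  \<open>m^2\<close> and \<open>n\<close>; after division by \<open>m^2\<close> they contribute at
  most \<open>2 * C / m\<close>.\<close>

lemma average_tendsto_zero_of_squares:
  fixes d :: "nat \<Rightarrow> real"
  assumes bound: "\<And>k. \<bar>d k\<bar> \<le> C"
    and squares: "(\<lambda>m. (\<Sum>k<m\<^sup>2. d k) / real (m\<^sup>2)) \<longlonglongrightarrow> 0"
  shows "(\<lambda>n. (\<Sum>k<n. d k) / real n) \<longlonglongrightarrow> 0"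
proof (rule Lim_null_comparison)
  let ?S = "\<lambda>n. \<Sum>k<n. d k"
  let ?B = "\<lambda>m. \<bar>?S (m\<^sup>2) / real (m\<^sup>2)\<bar> + 2 * C / real m"
  have "?B \<longlonglongrightarrow> \<bar>0\<bar> + 0"
    by (intro tendsto_add tendsto_rabs squares lim_const_over_n)
  then have "?B \<longlonglongrightarrow> 0" by simp
  then show "(\<lambda>n. ?B (floor_sqrt n)) \<longlonglongrightarrow> 0"
    by (rule filterlim_compose[OF _ filterlim_floor_sqrt_at_top])
  show "\<forall>\<^sub>F n in sequentially. norm (?S n / real n) \<le> ?B (floor_sqrt n)"
  proof (rule eventually_mono[OF eventually_gt_at_top[of 0]])
    fix n :: nat assume n: "0 < n"
    define m where "m = floor_sqrt n"
    have m: "0 < m" "m\<^sup>2 \<le> n" "n \<le> m\<^sup>2 + 2 * m"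
      using n Suc_floor_sqrt_power2_gt[of n] floor_sqrt_power2_le[of n]
      unfolding m_def[symmetric] by (auto simp: m_def power2_eq_square simp del: floor_sqrt_power2_le)
    have C: "0 \<le> C" using bound[of 0] by simp
    have "?S n = ?S (m\<^sup>2) + sum d {m\<^sup>2..<n}"
      using m(2) by (simp add: lessThan_atLeast0 sum.atLeastLessThan_concat)
    moreover have "\<bar>sum d {m\<^sup>2..<n}\<bar> \<le> (\<Sum>k\<in>{m\<^sup>2..<n}. C)"
      using bound by (intro order_trans[OF sum_abs] sum_mono)
    moreover have "(\<Sum>k\<in>{m\<^sup>2..<n}. C) \<le> 2 * real m * C"
    proof -
      have "real (n - m\<^sup>2) \<le> 2 * real m" using m by linarith
      then show ?thesis using C by (simp add: mult_right_mono)
    qed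
    ultimately have "\<bar>?S n\<bar> \<le> \<bar>?S (m\<^sup>2)\<bar> + 2 * real m * C" by linarith
    then have "\<bar>?S n\<bar> / real n \<le> (\<bar>?S (m\<^sup>2)\<bar> + 2 * real m * C) / real n"
      by (simp add: divide_right_mono)
    also have "\<dots> \<le> (\<bar>?S (m\<^sup>2)\<bar> + 2 * real m * C) / real (m\<^sup>2)"
      using m C n by (intro divide_left_mono) (auto intro!: mult_pos_pos simp del: of_nat_power)
    also have "\<dots> = ?B m"
      using m by (simp add: add_divide_distrib power2_eq_square)
    finally show "norm (?S n / real n) \<le> ?B (floor_sqrt n)"
      by (simp add: m_def)
  qed
qed

text \<open>The mean square of the average of \<open>n\<close> terms is at most
  \<open>C^2 / n\<close>, in general not summable over all \<open>n\<close> but summable over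
  perfect squares. Convergence is therefore shown along squares first, and boundedness fills the
  gaps.\<close>

lemma (in prob_space) AE_average_tendsto_zero:
  fixes D :: "nat \<Rightarrow> 'a \<Rightarrow> real"
  assumes [measurable]: "\<And>k. D k \<in> borel_measurable M"
    and bound: "\<And>k \<omega>. \<bar>D k \<omega>\<bar> \<le> C"
    and uncorrelated: "\<And>j k. j < k \<Longrightarrow> expectation (\<lambda>\<omega>. D j \<omega> * D k \<omega>) = 0"
  shows "AE \<omega> in M. (\<lambda>n. (\<Sum>k<n. D k \<omega>) / real n) \<longlonglongrightarrow> 0"
proof -
  \<comment> \<open>\<open>Suc m\<close> keeps the divisor positive; \<open>LIMSEQ_imp_Suc\<close>
    undoes the shift at the end.\<close>
  define Y where "Y m \<omega> = ((\<Sum>k<(Suc m)\<^sup>2. D k \<omega>) / real ((Suc m)\<^sup>2))\<^sup>2" for m \<omega>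
  have [measurable]: "Y m \<in> borel_measurable M" for m
    unfolding Y_def by measurable
  have Y0: "0 \<le> Y m \<omega>" for m \<omega> by (simp add: Y_def)
  have EY: "(\<integral>\<^sup>+\<omega>. ennreal (Y m \<omega>) \<partial>M) \<le> ennreal (C\<^sup>2 * (1 / real (Suc m) ^ 2))" for m
  proof -
    have "\<bar>\<Sum>k<n. D k \<omega>\<bar> \<le> real n * C" for n \<omega>
      using bound order_trans[OF sum_abs sum_mono[of "{..<n}" "\<lambda>k. \<bar>D k \<omega>\<bar>" "\<lambda>_. C"]] by simp
    then have "AE \<omega> in M. norm ((\<Sum>k<n. D k \<omega>)\<^sup>2) \<le> (real n * C)\<^sup>2" for n
      by (intro AE_I2) (simp add: abs_le_square_iff[symmetric] order_trans[OF _ abs_ge_self])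
    then have "integrable M (\<lambda>\<omega>. (\<Sum>k<n. D k \<omega>)\<^sup>2)" for n
      by (intro integrable_const_bound[where B = "(real n * C)\<^sup>2"]) simp_all
    then have int: "integrable M (Y m)"
      unfolding Y_def power_divide by (intro integrable_divide)
    have "(\<integral>\<^sup>+\<omega>. ennreal (Y m \<omega>) \<partial>M) = ennreal (expectation (Y m))"
      using int Y0 by (intro nn_integral_eq_integral) auto
    also have "expectation (Y m) =
        expectation (\<lambda>\<omega>. (\<Sum>k<(Suc m)\<^sup>2. D k \<omega>)\<^sup>2) / (real ((Suc m)\<^sup>2))\<^sup>2"
      unfolding Y_def power_divide by simp
    also have "\<dots> \<le> real ((Suc m)\<^sup>2) * C\<^sup>2 / (real ((Suc m)\<^sup>2))\<^sup>2"
      by (intro divide_right_mono bounded_uncorrelated_second_moment bound uncorrelated) auto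
    also have "\<dots> = C\<^sup>2 * (1 / real (Suc m) ^ 2)"
      unfolding of_nat_power by (simp add: power2_eq_square del: of_nat_Suc)
    finally show ?thesis by (simp add: ennreal_leI)
  qed
  have summ: "summable (\<lambda>m. C\<^sup>2 * (1 / real (Suc m) ^ 2))"
    using inverse_power_summable[of 2, where 'a = real]
    by (intro summable_mult) (subst summable_Suc_iff, simp add: inverse_eq_divide)
  \<comment> \<open>A finite expected sum makes the series finite almost surely, so its terms tend
    to zero; this takes the place of Borel-Cantelli.\<close>
  have "(\<integral>\<^sup>+\<omega>. (\<Sum>m. ennreal (Y m \<omega>)) \<partial>M) = (\<Sum>m. \<integral>\<^sup>+\<omega>. ennreal (Y m \<omega>) \<partial>M)"
    by (rule nn_integral_suminf) simp
  also have "\<dots> \<le> (\<Sum>m. ennreal (C\<^sup>2 * (1 / real (Suc m) ^ 2)))"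
    by (intro suminf_le EY) auto
  also have "\<dots> < \<infinity>"
    using summ by (subst suminf_ennreal2) auto
  finally have "AE \<omega> in M. (\<Sum>m. ennreal (Y m \<omega>)) \<noteq> \<infinity>"
    by (intro nn_integral_noteq_infinite) auto
  then show ?thesis
  proof (rule AE_mp, intro AE_I2 impI)
    fix \<omega> assume "(\<Sum>m. ennreal (Y m \<omega>)) \<noteq> \<infinity>"
    then have "summable (\<lambda>m. Y m \<omega>)"
      using Y0 by (intro summable_suminf_not_top) auto
    then have "(\<lambda>m. Y m \<omega>) \<longlonglongrightarrow> 0" by (rule summable_LIMSEQ_zero)
    then have "(\<lambda>m. sqrt (Y m \<omega>)) \<longlonglongrightarrow> 0"
      using tendsto_real_sqrt by fastforce
    then have "(\<lambda>m. (\<Sum>k<(Suc m)\<^sup>2. D k \<omega>) / real ((Suc m)\<^sup>2)) \<longlonglongrightarrow> 0"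
      unfolding Y_def real_sqrt_abs by (simp only: tendsto_rabs_zero_iff)
    then have "(\<lambda>m. (\<Sum>k<m\<^sup>2. D k \<omega>) / real (m\<^sup>2)) \<longlonglongrightarrow> 0"
      by (rule LIMSEQ_imp_Suc)
    then show "(\<lambda>n. (\<Sum>k<n. D k \<omega>) / real n) \<longlonglongrightarrow> 0"
      by (rule average_tendsto_zero_of_squares[OF bound])
  qed
qed

section \<open>The Markov chain of windows\<close>

text \<open>All of \<open>w\<close> is counted, so a longer history has to be cut to its first
  \<open>N\<close> entries beforehand.\<close>

definition jump_prob :: "nat \<Rightarrow> real \<Rightarrow> real \<Rightarrow> bool list \<Rightarrow> real" where
  "jump_prob M p0 p1 w = (if M \<le> count_list w True then p1 else p0)"

text \<open>The operator \<open>K\<close> of the overview. The new jump enters at the head, and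
  \<open>take N\<close> drops the oldest one from the end.\<close>

definition window_op ::
  "nat \<Rightarrow> nat \<Rightarrow> real \<Rightarrow> real \<Rightarrow> (bool list \<Rightarrow> real) \<Rightarrow> bool list \<Rightarrow> real" where
  "window_op N M p0 p1 f w = jump_prob M p0 p1 w * f (take N (True # w))
    + (1 - jump_prob M p0 p1 w) * f (take N (False # w))"

lemma jump_prob_bounds:
  assumes "p0 \<le> p1"
  shows "p0 \<le> jump_prob M p0 p1 w" "jump_prob M p0 p1 w \<le> p1"
  using assms by (auto simp: jump_prob_def)

section \<open>Minorisation and contraction of the transition operator\<close>

text \<open>Turns lower bounds on iterates into upper bounds by passing to
  \<open>- f\<close>.\<close>

lemma window_op_power_uminus:
  "(window_op N M p0 p1 ^^ j) (\<lambda>w. - f w) = (\<lambda>w. - (window_op N M p0 p1 ^^ j) f w)"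
  by (induction j) (auto simp: window_op_def algebra_simps)

text \<open>Whatever the window, a right jump has probability at least \<open>p0\<close>. Hence
  \<open>j\<close> right jumps in a row have probability at least \<open>p0 ^ j\<close>, and all
  other continuations still contribute values of at least \<open>a\<close>.\<close>

lemma window_op_power_ge:
  assumes p: "0 < p0" "p0 \<le> p1" "p1 \<le> 1"
    and low: "\<And>w. length w = N \<Longrightarrow> a \<le> f w" and w: "length w = N"
  shows "a + p0 ^ j * (f (take N (replicate j True @ w)) - a) \<le> (window_op N M p0 p1 ^^ j) f w"
  using w
proof (induction j arbitrary: w)
  case (Suc j)
  let ?q = "jump_prob M p0 p1 w" and ?g = "(window_op N M p0 p1 ^^ j) f"
  let ?r = "p0 ^ j * (f (take N (replicate (Suc j) True @ w)) - a)"
  have q: "p0 \<le> ?q" "?q \<le> 1"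
    using p jump_prob_bounds[of p0 p1 M w] by auto
  have len: "length (take N (b # w)) = N" for b
    using Suc.prems by simp
  \<comment> \<open>Truncating at every step or only once at the end gives the same window.\<close>
  have "take N (replicate j True @ take N (True # w)) = take N (replicate (Suc j) True @ w)"
  proof -
    have "take N (xs @ take N ys) = take N (xs @ ys)" for xs ys :: "bool list" by simp
    then show ?thesis by (simp only: replicate_app_Cons_same replicate_Suc append_Cons)
  qed
  then have T: "a + ?r \<le> ?g (take N (True # w))"
    using Suc.IH[OF len] by metis
  \<comment> \<open>For the left branch the gain in the induction hypothesis is discarded, leaving
    the plain bound \<open>a\<close>.\<close>
  have "0 \<le> p0 ^ j * (f (take N (replicate j True @ take N (False # w))) - a)"
    using p Suc.prems by (intro mult_nonneg_nonneg) (auto intro!: low)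
  then have F: "a \<le> ?g (take N (False # w))"
    using Suc.IH[OF len, of False] by linarith
  have r: "0 \<le> ?r"
    using p Suc.prems by (intro mult_nonneg_nonneg) (auto intro!: low)
  have "a + p0 * ?r \<le> a + ?q * ?r"
    using q r by (intro add_left_mono mult_right_mono)
  also have "\<dots> = ?q * (a + ?r) + (1 - ?q) * a"
    by (simp add: algebra_simps)
  also have "\<dots> \<le> ?q * ?g (take N (True # w)) + (1 - ?q) * ?g (take N (False # w))"
    using q p T F by (intro add_mono mult_left_mono) auto
  finally show ?case
    unfolding funpow.simps comp_def window_op_def[of N M p0 p1 "(window_op N M p0 p1 ^^ j) f"]
    by (simp only: power_Suc mult.assoc)
qed simp

lemma window_op_power_le:
  assumes p: "0 < p0" "p0 \<le> p1" "p1 \<le> 1"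
    and up: "\<And>w. length w = N \<Longrightarrow> f w \<le> b" and w: "length w = N"
  shows "(window_op N M p0 p1 ^^ j) f w \<le> b - p0 ^ j * (b - f (take N (replicate j True @ w)))"
  using window_op_power_ge[OF p, of N "- b" "\<lambda>w. - f w" w j M] up w
  by (simp add: window_op_power_uminus algebra_simps)

text \<open>Doeblin's argument: from every window, \<open>N\<close> consecutive right jumps lead to the same
  window with probability at least \<open>p0 ^ N\<close>, so \<open>N\<close> steps shrink the oscillation by a
  fixed factor.\<close>
lemma window_op_contracts:
  assumes p: "0 < p0" "p0 \<le> p1" "p1 \<le> 1"
    and f: "\<And>w. length w = N \<Longrightarrow> a \<le> f w \<and> f w \<le> b"
  shows "\<exists>a' b'. (\<forall>w. length w = N \<longrightarrow>
      a' \<le> (window_op N M p0 p1 ^^ (N * i)) f w \<and> (window_op N M p0 p1 ^^ (N * i)) f w \<le> b')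
    \<and> b' - a' = (1 - p0 ^ N) ^ i * (b - a)"
proof (induction i)
  case 0
  then show ?case using f by auto
next
  case (Suc i)
  let ?g = "(window_op N M p0 p1 ^^ (N * i)) f" and ?t = "replicate N True"
  obtain a' b' where ab: "\<And>w. length w = N \<Longrightarrow> a' \<le> ?g w" "\<And>w. length w = N \<Longrightarrow> ?g w \<le> b'"
    "b' - a' = (1 - p0 ^ N) ^ i * (b - a)"
    using Suc by blast
  have *: "(window_op N M p0 p1 ^^ (N * Suc i)) f = (window_op N M p0 p1 ^^ N) ?g"
    by (simp add: funpow_add)
  show ?case
  proof (intro exI conjI allI impI)
    fix w :: "bool list" assume w: "length w = N"
    \<comment> \<open>After \<open>N\<close> right jumps the window is \<open>?t\<close>,
      independently of \<open>w\<close>. The same value \<open>?g ?t\<close> thus enters both new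
      bounds and cancels in their difference.\<close>
    show "a' + p0 ^ N * (?g ?t - a') \<le> (window_op N M p0 p1 ^^ (N * Suc i)) f w"
      using window_op_power_ge[OF p ab(1) w, where j = N] unfolding * by simp
    show "(window_op N M p0 p1 ^^ (N * Suc i)) f w \<le> b' - p0 ^ N * (b' - ?g ?t)"
      using window_op_power_le[OF p ab(2) w, where j = N] unfolding * by simp
  next
    have "(b' - p0 ^ N * (b' - ?g ?t)) - (a' + p0 ^ N * (?g ?t - a')) = (1 - p0 ^ N) * (b' - a')"
      by (simp add: algebra_simps)
    then show "(b' - p0 ^ N * (b' - ?g ?t)) - (a' + p0 ^ N * (?g ?t - a'))
        = (1 - p0 ^ N) ^ Suc i * (b - a)"
      by (simp add: ab(3) mult.assoc)
  qed
qed

section \<open>Summation over Boolean lists\<close>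

lemma finite_bool_lists: "finite {w :: bool list. length w = n}"
  using finite_lists_length_eq[of "UNIV :: bool set" n] by simp

lemma sum_bool_lists_Cons:
  "(\<Sum>w | length w = Suc n. f w) = (\<Sum>v | length v = n. f (True # v) + f (False # v))"
proof -
  have "{w. length w = Suc n} = Cons True ` {v. length v = n} \<union> Cons False ` {v. length v = n}"
    by (auto simp: length_Suc_conv image_iff)
  then have "(\<Sum>w | length w = Suc n. f w) =
      sum f (Cons True ` {v. length v = n}) + sum f (Cons False ` {v. length v = n})"
    by (simp only:) (rule sum.union_disjoint; auto simp: finite_bool_lists)
  then show ?thesis
    by (simp add: sum.reindex sum.distrib)
qed

text \<open>Splits off the oldest jump, the one that a transition forgets; reversing the lists
  reduces this to splitting off the head.\<close>

lemma sum_bool_lists_snoc: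
  "(\<Sum>w | length w = Suc n. f w) = (\<Sum>v | length v = n. f (v @ [True]) + f (v @ [False]))"
proof -
  have rev: "(\<Sum>w | length w = m. g (rev w)) = (\<Sum>w | length w = m. g w)"
    for m and g :: "bool list \<Rightarrow> 'a"
    by (rule sum.reindex_bij_witness[where i = rev and j = rev]) auto
  have "(\<Sum>w | length w = Suc n. f w) = (\<Sum>w | length w = Suc n. f (rev w))"
    by (rule rev[symmetric])
  also have "\<dots> = (\<Sum>v | length v = n. f (rev v @ [True]) + f (rev v @ [False]))"
    by (simp add: sum_bool_lists_Cons)
  also have "\<dots> = (\<Sum>v | length v = n. f (v @ [True]) + f (v @ [False]))"
    by (rule rev)
  finally show ?thesis .
qed

text \<open>Pascal's rule, with the head of the list deciding between the two binomial
  coefficients.\<close>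

lemma sum_bool_lists_count:
  fixes G :: "nat \<Rightarrow> real"
  shows "(\<Sum>w | length w = n. G (count_list w True)) = (\<Sum>j\<le>n. real (n choose j) * G j)"
proof (induction n arbitrary: G)
  case (Suc n)
  have "(\<Sum>w | length w = Suc n. G (count_list w True))
      = (\<Sum>j\<le>n. real (n choose j) * G (Suc j)) + (\<Sum>j\<le>n. real (n choose j) * G j)"
    by (simp add: sum_bool_lists_Cons sum.distrib Suc.IH[of "\<lambda>j. G (Suc j)"] Suc.IH)
  \<comment> \<open>The added term vanishes because \<open>n choose Suc n\<close> is zero.\<close>
  also have "(\<Sum>j\<le>n. real (n choose j) * G j) = (\<Sum>j\<le>Suc n. real (n choose j) * G j)"
    by simp
  also have "\<dots> = G 0 + (\<Sum>j\<le>n. real (n choose Suc j) * G (Suc j))"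
    by (subst sum.atMost_Suc_shift) simp
  also have "(\<Sum>j\<le>n. real (n choose j) * G (Suc j)) + \<dots>
      = G 0 + (\<Sum>j\<le>n. real (Suc n choose Suc j) * G (Suc j))"
    by (simp add: sum.distrib algebra_simps)
  also have "\<dots> = (\<Sum>j\<le>Suc n. real (Suc n choose j) * G j)"
    by (subst sum.atMost_Suc_shift) simp
  finally show ?case .
qed simp

section \<open>The stationary weight of a window\<close>

text \<open>An unnormalised solution of the balance equation: consecutive ratios are
  \<open>p0 / (1 - p0)\<close> below the threshold, \<open>p0 / (1 - p1)\<close> on reaching it and
  \<open>p1 / (1 - p1)\<close> above it. The prefactors account for the mixed ratio.\<close>

definition weight :: "nat \<Rightarrow> real \<Rightarrow> real \<Rightarrow> nat \<Rightarrow> real" where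
  "weight M p0 p1 j = (if j < M then 1 / (1 - p0) * (p0 / (1 - p0)) ^ j
    else 1 / (1 - p1) * (p0 / (1 - p0)) ^ M * (p1 / (1 - p1)) ^ (j - M))"

lemma weight_pos:
  assumes "0 < p0" "p0 < 1" "0 < p1" "p1 < 1"
  shows "0 < weight M p0 p1 j"
  using assms by (simp add: weight_def)

lemma weight_balance:
  assumes "p0 < 1" "p1 < 1"
  shows "weight M p0 p1 (Suc j) * (1 - (if M \<le> Suc j then p1 else p0))
    = weight M p0 p1 j * (if M \<le> j then p1 else p0)"
proof -
  have power: "(p / (1 - p)) ^ Suc i * (1 - p) = (p / (1 - p)) ^ i * p" if "p < 1" for p :: real and i
    using that by simp
  consider "Suc j < M" | "Suc j = M" | "M \<le> j" by linarith
  then show ?thesis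
  proof cases
    case 1
    then show ?thesis using power[OF assms(1)] by (simp only: weight_def mult.assoc) simp
  next
    case 3
    then have "Suc j - M = Suc (j - M)" by simp
    then show ?thesis using 3 power[OF assms(2)] by (simp only: weight_def mult.assoc) simp
  qed (use assms in \<open>auto simp: weight_def field_simps\<close>)
qed

text \<open>The predecessors of \<open>b # v\<close> are \<open>v @ [True]\<close> and
  \<open>v @ [False]\<close>. If \<open>v\<close> has \<open>k\<close> right jumps, balance turns
  the mass flowing into \<open>True # v\<close> into the weight of \<open>Suc k\<close>, and that
  flowing into \<open>False # v\<close> into the weight of \<open>k\<close>.\<close>

lemma weight_stationary:
  assumes p: "p0 < 1" "p1 < 1"
  shows "(\<Sum>w | length w = Suc n. weight M p0 p1 (count_list w True) * window_op (Suc n) M p0 p1 f w)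
    = (\<Sum>w | length w = Suc n. weight M p0 p1 (count_list w True) * f w)"
proof -
  let ?g = "weight M p0 p1" and ?q = "\<lambda>j. if M \<le> j then p1 else p0"
  have "(\<Sum>w | length w = Suc n. ?g (count_list w True) * window_op (Suc n) M p0 p1 f w)
      = (\<Sum>v | length v = n.
          ?g (Suc (count_list v True)) * window_op (Suc n) M p0 p1 f (v @ [True])
          + ?g (count_list v True) * window_op (Suc n) M p0 p1 f (v @ [False]))"
    by (simp add: sum_bool_lists_snoc)
  also have "\<dots> = (\<Sum>v | length v = n.
      ?g (Suc (count_list v True)) * f (True # v) + ?g (count_list v True) * f (False # v))"
  proof (rule sum.cong[OF refl])
    fix v :: "bool list" assume "v \<in> {v. length v = n}"
    then have len: "length v = n" by simp
    define k where "k = count_list v True"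
    have "window_op (Suc n) M p0 p1 f (v @ [True])
        = ?q (Suc k) * f (True # v) + (1 - ?q (Suc k)) * f (False # v)"
      "window_op (Suc n) M p0 p1 f (v @ [False]) = ?q k * f (True # v) + (1 - ?q k) * f (False # v)"
      using len by (simp_all add: window_op_def jump_prob_def k_def)
    then have "?g (Suc k) * window_op (Suc n) M p0 p1 f (v @ [True])
        + ?g k * window_op (Suc n) M p0 p1 f (v @ [False])
      = (?g (Suc k) * ?q (Suc k) + ?g k * ?q k) * f (True # v)
        + (?g (Suc k) * (1 - ?q (Suc k)) + ?g k * (1 - ?q k)) * f (False # v)"
      by (simp only:) (simp only: algebra_simps)
    \<comment> \<open>Balance replaces \<open>?g k * ?q k\<close> here; in the next identity it
      replaces \<open>?g (Suc k) * (1 - ?q (Suc k))\<close>.\<close>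
    also have "?g (Suc k) * ?q (Suc k) + ?g k * ?q k = ?g (Suc k)"
      unfolding weight_balance[OF p, of M k, symmetric] by (simp add: algebra_simps)
    also have "?g (Suc k) * (1 - ?q (Suc k)) + ?g k * (1 - ?q k) = ?g k"
      unfolding weight_balance[OF p, of M k] by (simp add: algebra_simps)
    finally show "?g (Suc (count_list v True)) * window_op (Suc n) M p0 p1 f (v @ [True])
          + ?g (count_list v True) * window_op (Suc n) M p0 p1 f (v @ [False])
        = ?g (Suc (count_list v True)) * f (True # v) + ?g (count_list v True) * f (False # v)"
      by (simp only: k_def)
  qed
  also have "\<dots> = (\<Sum>w | length w = Suc n. ?g (count_list w True) * f w)"
    by (simp add: sum_bool_lists_Cons)
  finally show ?thesis .
qed

definition stationary_mean ::
  "nat \<Rightarrow> nat \<Rightarrow> real \<Rightarrow> real \<Rightarrow> (bool list \<Rightarrow> real) \<Rightarrow> real" where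
  "stationary_mean N M p0 p1 f =
    (\<Sum>w | length w = N. weight M p0 p1 (count_list w True) * f w)
      / (\<Sum>w | length w = N. weight M p0 p1 (count_list w True))"

lemma stationary_mean_window_op_power:
  assumes p: "p0 < 1" "p1 < 1" and "0 < N"
  shows "stationary_mean N M p0 p1 ((window_op N M p0 p1 ^^ j) f) = stationary_mean N M p0 p1 f"
proof (induction j)
  case (Suc j)
  obtain n where "N = Suc n" using \<open>0 < N\<close> gr0_implies_Suc by blast
  then show ?case
    using Suc by (simp add: stationary_mean_def weight_stationary[OF p])
qed simp

lemma stationary_mean_bounds:
  assumes p: "0 < p0" "p0 < 1" "0 < p1" "p1 < 1"
    and f: "\<And>w. length w = N \<Longrightarrow> a \<le> f w \<and> f w \<le> b"
  shows "a \<le> stationary_mean N M p0 p1 f" "stationary_mean N M p0 p1 f \<le> b"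
proof -
  let ?g = "\<lambda>w. weight M p0 p1 (count_list w True)" and ?W = "{w :: bool list. length w = N}"
  have "?W \<noteq> {}" using length_replicate[of N True] by blast
  then have Z: "0 < sum ?g ?W"
    using weight_pos[OF p] by (intro sum_pos finite_bool_lists) auto
  have "a * sum ?g ?W \<le> (\<Sum>w\<in>?W. ?g w * f w)" "(\<Sum>w\<in>?W. ?g w * f w) \<le> b * sum ?g ?W"
    unfolding sum_distrib_left using f less_imp_le[OF weight_pos[OF p]]
    by (auto intro!: sum_mono mult_left_mono simp: mult.commute[of a] mult.commute[of b])
  then show "a \<le> stationary_mean N M p0 p1 f" "stationary_mean N M p0 p1 f \<le> b"
    using Z by (auto simp: stationary_mean_def pos_le_divide_eq pos_divide_le_eq)
qed

text \<open>Iterating leaves the stationary mean unchanged, so it lies between any bounds for the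
  iterate; contraction makes the gap between such bounds arbitrarily small.\<close>

lemma window_op_power_near_mean:
  assumes p: "0 < p0" "p0 \<le> p1" "p1 < 1" and "0 < N" and "0 < \<epsilon>"
  shows "\<exists>m. \<forall>w. length w = N \<longrightarrow>
    \<bar>(window_op N M p0 p1 ^^ m) f w - stationary_mean N M p0 p1 f\<bar> < \<epsilon>"
proof -
  \<comment> \<open>A crude uniform bound for \<open>f\<close> on the finitely many windows.\<close>
  define b where "b = (\<Sum>w | length w = N. \<bar>f w\<bar>)"
  have f: "- b \<le> f w \<and> f w \<le> b" if "length w = N" for w
    using member_le_sum[of w "{w. length w = N}" "\<lambda>w. \<bar>f w\<bar>"] that
    by (auto simp: b_def finite_bool_lists abs_le_iff)
  have "p0 ^ N \<le> 1" using p by (intro power_le_one) auto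
  then have "(\<lambda>i. (1 - p0 ^ N) ^ i) \<longlonglongrightarrow> 0"
    using p by (intro LIMSEQ_realpow_zero) auto
  from tendsto_mult_right_zero[OF this] have "(\<lambda>i. (1 - p0 ^ N) ^ i * (b - (- b))) \<longlonglongrightarrow> 0" 
    by (simp add: mult.commute)
  from order_tendstoD(2)[OF this \<open>0 < \<epsilon>\<close>] obtain i where i: "(1 - p0 ^ N) ^ i * (b - (- b)) < \<epsilon>"
    by (auto simp: eventually_sequentially)
  obtain a' b' where ab: "\<And>w. length w = N \<Longrightarrow>
      a' \<le> (window_op N M p0 p1 ^^ (N * i)) f w \<and> (window_op N M p0 p1 ^^ (N * i)) f w \<le> b'"
    "b' - a' = (1 - p0 ^ N) ^ i * (b - (- b))"
    using window_op_contracts[where i = i and M = M, of p0 p1 N "- b" f b] p f by auto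
  have "a' \<le> stationary_mean N M p0 p1 f" "stationary_mean N M p0 p1 f \<le> b'"
    using stationary_mean_bounds[of p0 p1 N a' "(window_op N M p0 p1 ^^ (N * i)) f" b' M] ab(1) p
      stationary_mean_window_op_power[of p0 p1 N M "N * i" f] \<open>0 < N\<close> by auto
  then show ?thesis
    using ab i by (intro exI[of _ "N * i"]) (fastforce simp: abs_less_iff)
qed

section \<open>The stationary mean of the last jump\<close>

definition last_jump :: "bool list \<Rightarrow> real" where
  "last_jump w = (if hd w then 1 else - 1)"

text \<open>Among the windows with \<open>j\<close> right jumps a fraction \<open>j / N\<close>
  begins with one, so the last jump averages \<open>2 * j / N - 1\<close> over them. Summing by
  \<open>j\<close> and cutting at the threshold gives the formula.\<close>

lemma stationary_mean_last_jump:
  assumes "1 \<le> M" "M \<le> N"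
  shows "stationary_mean N M p0 p1 last_jump = speed_formula N M p0 p1"
proof -
  let ?g = "weight M p0 p1"
  obtain n where N: "N = Suc n" using assms by (cases N) auto
  \<comment> \<open>Used with \<open>h j = 2 * j / N - 1\<close> for the numerator and
    \<open>h j = 1\<close> for the denominator.\<close>
  have split: "(\<Sum>j\<le>N. real (N choose j) * (h j * ?g j)) =
      1 / (1 - p0) * (\<Sum>j=0..M - 1. h j * real (N choose j) * (p0 / (1 - p0)) ^ j)
      + 1 / (1 - p1) * (p0 / (1 - p0)) ^ M *
        (\<Sum>j=M..N. h j * real (N choose j) * (p1 / (1 - p1)) ^ (j - M))" for h :: "nat \<Rightarrow> real"
  proof -
    \<comment> \<open>\<open>1 \<le> M\<close> matters: for \<open>M = 0\<close> truncated
      subtraction would make the two ranges overlap at \<open>0\<close>.\<close>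
    have U: "{..N} = {0..M - 1} \<union> {M..N}" "{0..M - 1} \<inter> {M..N} = {}" using assms by auto
    show ?thesis
      unfolding U(1) using assms U(2)
      by (subst sum.union_disjoint)
         (auto simp: weight_def sum_distrib_left intro!: arg_cong2[where f = "(+)"] sum.cong)
  qed
  have coeff: "real (N choose j) * (2 * real j / real N - 1)
      = (if j = 0 then 0 else real (n choose (j - 1))) - real (n choose j)" for j
  proof (cases j)
    case (Suc i)
    have "real (Suc i) * real (N choose j) = real N * real (n choose i)"
      unfolding N Suc using Suc_times_binomial_eq[of n i] by (metis mult.commute of_nat_mult)
    then have x: "real (N choose j) * (real j / real N) = real (n choose i)"
      unfolding Suc by (simp add: N field_simps)
    have "real (N choose j) = real (n choose i) + real (n choose j)"
      by (simp add: N Suc)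
    then have "2 * (real (N choose j) * (real j / real N)) - real (N choose j)
        = real (n choose i) - real (n choose j)"
      unfolding x by simp
    then show ?thesis
      unfolding Suc by (simp only: right_diff_distrib mult_1_right nat.distinct if_False diff_Suc_1)
        (simp only: times_divide_eq_right mult.left_commute)
  qed (simp add: N)
  have "(\<Sum>w | length w = N. ?g (count_list w True) * last_jump w)
      = (\<Sum>v | length v = n. ?g (Suc (count_list v True)) - ?g (count_list v True))"
    by (simp add: N sum_bool_lists_Cons last_jump_def)
  also have "\<dots> = (\<Sum>j\<le>n. real (n choose j) * (?g (Suc j) - ?g j))"
    by (rule sum_bool_lists_count)
  \<comment> \<open>The second range grows to \<open>N\<close> for free, as
    \<open>n choose N\<close> is zero.\<close>
  also have "\<dots> = (\<Sum>j\<le>n. real (n choose j) * ?g (Suc j)) - (\<Sum>j\<le>N. real (n choose j) * ?g j)"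
    by (simp add: N sum_subtractf algebra_simps)
  also have "(\<Sum>j\<le>n. real (n choose j) * ?g (Suc j))
      = (\<Sum>j\<le>N. (if j = 0 then 0 else real (n choose (j - 1))) * ?g j)"
    unfolding N by (subst sum.atMost_Suc_shift) simp
  also have "\<dots> - (\<Sum>j\<le>N. real (n choose j) * ?g j)
      = (\<Sum>j\<le>N. real (N choose j) * ((2 * real j / real N - 1) * ?g j))"
    by (simp only: sum_subtractf[symmetric] left_diff_distrib[symmetric] coeff[symmetric] mult.assoc)
  finally have num: "(\<Sum>w | length w = N. ?g (count_list w True) * last_jump w)
      = (\<Sum>j\<le>N. real (N choose j) * ((2 * real j / real N - 1) * ?g j))" .
  have den: "(\<Sum>w | length w = N. ?g (count_list w True)) = (\<Sum>j\<le>N. real (N choose j) * (1 * ?g j))"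
    by (simp add: sum_bool_lists_count)
  show ?thesis
    unfolding stationary_mean_def speed_formula_def num den split by simp
qed

section \<open>Time averages along a single path\<close>

text \<open>A deterministic statement, with the probabilistic input confined to
  \<open>noise\<close>. Shifting time by one changes an average only by a boundary term of order
  \<open>1 / n\<close>, so \<open>noise\<close> makes the averages of successive iterates agree in
  the limit.\<close>

lemma window_op_average_limit:
  fixes W :: "nat \<Rightarrow> bool list"
  assumes p: "0 < p0" "p0 \<le> p1" "p1 < 1" and N: "0 < N" and len: "\<And>k. length (W k) = N"
    and noise: "\<And>j. (\<lambda>n. (\<Sum>k<n. (window_op N M p0 p1 ^^ j) f (W (Suc k))
      - (window_op N M p0 p1 ^^ Suc j) f (W k)) / real n) \<longlonglongrightarrow> 0"
  shows "(\<lambda>n. (\<Sum>k<n. f (W k)) / real n) \<longlonglongrightarrow> stationary_mean N M p0 p1 f"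
proof -
  define g where "g j = (window_op N M p0 p1 ^^ j) f" for j
  define A where "A j n = (\<Sum>k<n. g j (W k)) / real n" for j n
  let ?s = "stationary_mean N M p0 p1 f"
  have step: "(\<lambda>n. A (Suc j) n - A j n) \<longlonglongrightarrow> 0" for j
  proof -
    have "(\<lambda>n. (g j (W n) - g j (W 0)) / real n) \<longlonglongrightarrow> 0"
    proof (rule Lim_null_comparison)
      let ?b = "\<Sum>w | length w = N. \<bar>g j w\<bar>"
      show "(\<lambda>n. 2 * ?b / real n) \<longlonglongrightarrow> 0" by (rule lim_const_over_n)
      have b: "\<bar>g j (W n)\<bar> \<le> ?b" for n
        by (rule member_le_sum) (auto simp: len finite_bool_lists)
      have "\<bar>g j (W n) - g j (W 0)\<bar> \<le> 2 * ?b" for n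
        using b[of n] b[of 0] by linarith
      then show "\<forall>\<^sub>F n in sequentially. norm ((g j (W n) - g j (W 0)) / real n) \<le> 2 * ?b / real n"
        by (intro always_eventually allI) (simp add: divide_right_mono)
    qed
    from tendsto_diff[OF this noise[of j]]
    have "(\<lambda>n. (g j (W n) - g j (W 0)) / real n
        - (\<Sum>k<n. g j (W (Suc k)) - g (Suc j) (W k)) / real n) \<longlonglongrightarrow> 0"
      by (simp add: g_def)
    moreover have "(g j (W n) - g j (W 0)) / real n
        - (\<Sum>k<n. g j (W (Suc k)) - g (Suc j) (W k)) / real n = A (Suc j) n - A j n" for n
      using sum_lessThan_telescope[of "\<lambda>k. g j (W k)" n]
      unfolding A_def diff_divide_distrib[symmetric] by (simp add: sum_subtractf)
    ultimately show ?thesis by simp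
  qed
  have A: "(\<lambda>n. A j n - A 0 n) \<longlonglongrightarrow> 0" for j
  proof (induction j)
    case (Suc j)
    from tendsto_add[OF step[of j] Suc] show ?case by simp
  qed simp
  have "A 0 \<longlonglongrightarrow> ?s"
  proof (rule LIMSEQ_I)
    fix \<epsilon> :: real assume \<epsilon>: "0 < \<epsilon>"
    \<comment> \<open>\<open>m\<close> is fixed before \<open>n\<close> grows, so no uniformity in
      \<open>m\<close> is required of the preceding limits.\<close>
    obtain m where m: "\<And>w. length w = N \<Longrightarrow> \<bar>g m w - ?s\<bar> < \<epsilon> / 2"
      using window_op_power_near_mean[OF p N, of "\<epsilon> / 2" M f] \<epsilon> unfolding g_def by auto
    have near: "\<bar>A m n - ?s\<bar> \<le> \<epsilon> / 2" if "0 < n" for n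
    proof -
      have "A m n - ?s = (\<Sum>k<n. g m (W k) - ?s) / real n"
        using that by (simp add: A_def sum_subtractf field_simps)
      also have "\<bar>\<dots>\<bar> \<le> (\<Sum>k<n. \<epsilon> / 2) / real n"
        unfolding abs_divide abs_of_nat using m[OF len]
        by (intro divide_right_mono order_trans[OF sum_abs] sum_mono) (auto intro: less_imp_le)
      finally show ?thesis using that by simp
    qed
    obtain n0 where n0: "\<And>n. n0 \<le> n \<Longrightarrow> \<bar>A m n - A 0 n\<bar> < \<epsilon> / 2"
      using LIMSEQ_D[OF A[of m], of "\<epsilon> / 2"] \<epsilon> by auto
    show "\<exists>n0. \<forall>n\<ge>n0. norm (A 0 n - ?s) < \<epsilon>"
    \<comment> \<open>\<open>Suc n0\<close> ensures \<open>0 < n\<close>, as \<open>near\<close>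
      demands.\<close>
    proof (intro exI[of _ "Suc n0"] allI impI)
      fix n assume "Suc n0 \<le> n"
      then show "norm (A 0 n - ?s) < \<epsilon>"
        using n0[of n] near[of n] by simp (smt (verit) field_sum_of_halves)
    qed
  qed
  then show ?thesis
    by (simp add: A_def[abs_def] g_def)
qed

section \<open>The walk\<close>

text \<open>Windows and histories list the most recent jump first; \<open>True\<close> is a jump to the right.\<close>
definition jumps :: "(nat \<Rightarrow> int) \<Rightarrow> nat \<Rightarrow> bool list" where
  "jumps x n = map (\<lambda>k. x (Suc k) = x k + 1) (rev [0..<n])"

lemma length_jumps [simp]: "length (jumps x n) = n"
  by (simp add: jumps_def)

lemma jumps_0 [simp]: "jumps x 0 = []"
  and jumps_Suc: "jumps x (Suc n) = (x (Suc n) = x n + 1) # jumps x n"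
  by (simp_all add: jumps_def)

lemma jumps_eq_drop: "m \<le> n \<Longrightarrow> jumps x m = drop (n - m) (jumps x n)"
  by (simp add: jumps_def drop_map drop_rev)

lemma jumps_eq_iff: "jumps x n = jumps y n \<longleftrightarrow> (\<forall>k<n. (x (Suc k) = x k + 1) = (y (Suc k) = y k + 1))"
  by (auto simp: jumps_def)

text \<open>The two sides also agree for \<open>n < N\<close>: truncated subtraction starts the
  index set at \<open>0\<close>, and \<open>take N\<close> keeps the whole list.\<close>

lemma recent_right_jumps_eq_count:
  "recent_right_jumps N x n = count_list (take N (jumps x n)) True"
proof -
  let ?P = "\<lambda>k. x (Suc k) = x k + 1"
  have "count_list (take N (jumps x n)) True = length (filter ?P (rev [n - N..<n]))"
    by (simp add: jumps_def count_list_eq_length_filter take_map take_rev drop_upt filter_map comp_def)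
  also have "\<dots> = card (set (filter ?P (rev [n - N..<n])))"
    by (rule distinct_card[symmetric]) simp
  finally show ?thesis
    by (simp add: recent_right_jumps_def Collect_conj_eq[symmetric])
qed

lemma right_prob_eq_jump_prob:
  "right_prob N M p0 p1 x n = jump_prob M p0 p1 (take N (jumps x n))"
  by (simp add: right_prob_def jump_prob_def recent_right_jumps_eq_count)

lemma take_Cons_take: "take N (b # take N w) = take N (b # w)"
  by (cases N) simp_all

text \<open>The parts of \<open>R\<close> and \<open>L\<close> inside \<open>E\<close> are disjoint
  and exhaust its mass, so the rest of \<open>E\<close> is null. This yields steps of size one from
  jump probabilities alone.\<close>

lemma (in prob_space) AE_one_of_two:
  assumes [measurable]: "{\<omega> \<in> space M. E \<omega>} \<in> events" "{\<omega> \<in> space M. R \<omega>} \<in> events"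
      "{\<omega> \<in> space M. L \<omega>} \<in> events"
    and disj: "\<And>\<omega>. \<not> (R \<omega> \<and> L \<omega>)"
    and total: "\<P>(\<omega> in M. R \<omega> \<and> E \<omega>) + \<P>(\<omega> in M. L \<omega> \<and> E \<omega>) = \<P>(\<omega> in M. E \<omega>)"
  shows "AE \<omega> in M. E \<omega> \<longrightarrow> R \<omega> \<or> L \<omega>"
proof -
  let ?A = "{\<omega> \<in> space M. R \<omega> \<and> E \<omega>} \<union> {\<omega> \<in> space M. L \<omega> \<and> E \<omega>}"
  have "prob ?A = \<P>(\<omega> in M. R \<omega> \<and> E \<omega>) + \<P>(\<omega> in M. L \<omega> \<and> E \<omega>)"
    using disj by (intro finite_measure_Union) auto
  then have "prob ({\<omega> \<in> space M. E \<omega>} - ?A) = 0"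
    using total by (subst finite_measure_Diff) auto
  then have "AE \<omega> in M. \<omega> \<notin> {\<omega> \<in> space M. E \<omega>} - ?A"
    by (subst (asm) prob_eq_0) auto
  then show ?thesis by (rule AE_mp) (auto intro!: AE_I2)
qed

section \<open>Jump probabilities given the history, and the almost sure limit\<close>

context recent_history_walk
begin

lemmas [measurable] = random_variable_X

abbreviation history :: "nat \<Rightarrow> 'a \<Rightarrow> bool list" where
  "history n \<omega> \<equiv> jumps (\<lambda>k. X k \<omega>) n"

lemma measurable_history [measurable]: "history n \<in> measurable P (count_space UNIV)"
proof -
  have "{\<omega> \<in> space P. history n \<omega> = l} \<in> events" for l
  proof (induction n arbitrary: l)
    case (Suc n)
    show ?case
    proof (cases l)
      case (Cons b l')
      note [measurable] = Suc[of l']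
      show ?thesis unfolding jumps_Suc Cons list.inject by measurable
    qed (simp add: jumps_Suc)
  qed simp
  then show ?thesis
    by (subst measurable_count_space_eq2_countable) (auto simp: vimage_def Int_def conj_commute)
qed

lemma AE_start_and_jumps:
  "AE \<omega> in P. X 0 \<omega> = x0 \<and> (\<forall>n. X (Suc n) \<omega> = X n \<omega> + 1 \<or> X (Suc n) \<omega> = X n \<omega> - 1)"
proof -
  have "AE \<omega> in P. X (Suc n) \<omega> = X n \<omega> + 1 \<or> X (Suc n) \<omega> = X n \<omega> - 1" for n
  proof (cases "n < N")
    case True
    have "AE \<omega> in P. True \<longrightarrow> X (Suc n) \<omega> = X n \<omega> + 1 \<or> X (Suc n) \<omega> = X n \<omega> - 1"
      using initial_right[OF True] initial_left[OF True]
      by (intro AE_one_of_two) (auto simp: prob_space)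
    then show ?thesis by simp
  next
    case False
    \<comment> \<open>Trajectories up to time \<open>n\<close> are coded as lists because these are
      countable, unlike functions on \<open>nat\<close>; the quantifier over \<open>l\<close> can
      then move inside \<open>AE\<close>.\<close>
    have "AE \<omega> in P. (\<forall>k\<le>n. X k \<omega> = l ! k) \<longrightarrow>
        X (Suc n) \<omega> = X n \<omega> + 1 \<or> X (Suc n) \<omega> = X n \<omega> - 1" for l
    proof (cases "\<P>(\<omega> in P. \<forall>k\<le>n. X k \<omega> = l ! k) = 0")
      case True
      then show ?thesis
        by (subst (asm) prob_eq_0) (auto elim!: eventually_mono)
    next
      case pos: False
      then have "\<P>(\<omega> in P. \<forall>k\<le>n. X k \<omega> = l ! k) > 0"
        by (simp add: zero_less_measure_iff)
      from later_right[OF _ this] later_left[OF _ this] False pos show ?thesis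
        by (intro AE_one_of_two) (auto simp: cond_prob_def field_simps)
    qed
    then have "AE \<omega> in P. \<forall>l. (\<forall>k\<le>n. X k \<omega> = l ! k) \<longrightarrow>
        X (Suc n) \<omega> = X n \<omega> + 1 \<or> X (Suc n) \<omega> = X n \<omega> - 1"
      by (simp add: AE_all_countable)
    then show ?thesis
    proof (rule AE_mp, intro AE_I2 impI)
      fix \<omega>
      assume *: "\<forall>l. (\<forall>k\<le>n. X k \<omega> = l ! k) \<longrightarrow>
        X (Suc n) \<omega> = X n \<omega> + 1 \<or> X (Suc n) \<omega> = X n \<omega> - 1"
      have "\<forall>k\<le>n. X k \<omega> = map (\<lambda>k. X k \<omega>) [0..<Suc n] ! k"
        by (simp del: upt_Suc)
      with * show "X (Suc n) \<omega> = X n \<omega> + 1 \<or> X (Suc n) \<omega> = X n \<omega> - 1" by blast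
    qed
  qed
  then show ?thesis using start by (simp add: AE_all_countable)
qed

text \<open>The model conditions on positions, the chain on jump directions. Almost surely the start
  is \<open>x0\<close> and all steps have size one, so the directions determine the positions and
  the two events coincide.\<close>

lemma prob_history_and_right:
  assumes "N \<le> n"
  shows "\<P>(\<omega> in P. history n \<omega> = h \<and> X (Suc n) \<omega> = X n \<omega> + 1)
    = jump_prob M p0 p1 (take N h) * \<P>(\<omega> in P. history n \<omega> = h)"
proof (cases "\<P>(\<omega> in P. history n \<omega> = h) = 0")
  case True
  have "\<P>(\<omega> in P. history n \<omega> = h \<and> X (Suc n) \<omega> = X n \<omega> + 1) \<le> \<P>(\<omega> in P. history n \<omega> = h)"
    by (intro finite_measure_mono) auto
  then show ?thesis using True by (simp add: measure_le_0_iff)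
next
  case False
  define good where "good \<omega> \<longleftrightarrow>
    X 0 \<omega> = x0 \<and> (\<forall>n. X (Suc n) \<omega> = X n \<omega> + 1 \<or> X (Suc n) \<omega> = X n \<omega> - 1)" for \<omega>
  have AE_good: "AE \<omega> in P. good \<omega>"
    using AE_start_and_jumps by (simp add: good_def)
  \<comment> \<open>An event of positive probability meets the almost sure event
    \<open>good\<close>; the path of such a point serves as the reference path
    \<open>x\<close>.\<close>
  have "\<exists>\<omega>\<in>space P. history n \<omega> = h \<and> good \<omega>"
  proof (rule ccontr)
    assume none: "\<not> ?thesis"
    have "AE \<omega> in P. \<omega> \<notin> {\<omega> \<in> space P. history n \<omega> = h}"
      using AE_good AE_space by eventually_elim (use none in auto)
    then show False using False by (subst (asm) prob_eq_0[symmetric]) auto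
  qed
  then obtain \<omega>0 where \<omega>0: "history n \<omega>0 = h" "good \<omega>0" by blast
  define x where "x k = X k \<omega>0" for k
  have x: "jumps x n = h" using \<omega>0(1) by (simp add: x_def[abs_def])
  have path: "history n \<omega> = h \<longleftrightarrow> (\<forall>k\<le>n. X k \<omega> = x k)" if "good \<omega>" for \<omega>
  proof
    assume "history n \<omega> = h"
    then have same: "(X (Suc k) \<omega> = X k \<omega> + 1) = (x (Suc k) = x k + 1)" if "k < n" for k
      using x that by (auto simp: jumps_eq_iff)
    have "k \<le> n \<Longrightarrow> X k \<omega> = x k" for k
    proof (induction k)
      case 0
      then show ?case using \<open>good \<omega>\<close> \<omega>0(2) by (simp add: good_def x_def)
    next
      case (Suc k)
      then have "X k \<omega> = x k" and "k < n" by auto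
      moreover have "x (Suc k) = x k + 1 \<or> x (Suc k) = x k - 1"
        "X (Suc k) \<omega> = X k \<omega> + 1 \<or> X (Suc k) \<omega> = X k \<omega> - 1"
        using \<open>good \<omega>\<close> \<omega>0(2) by (auto simp: good_def x_def)
      ultimately show ?case using same[of k] by auto
    qed
    then show "\<forall>k\<le>n. X k \<omega> = x k" by blast
  next
    assume "\<forall>k\<le>n. X k \<omega> = x k"
    then have "history n \<omega> = jumps x n" unfolding jumps_eq_iff by simp
    with x show "history n \<omega> = h" by simp
  qed
  have AE_path: "AE \<omega> in P. history n \<omega> = h \<longleftrightarrow> (\<forall>k\<le>n. X k \<omega> = x k)"
    using AE_good by eventually_elim (rule path)
  have 1: "\<P>(\<omega> in P. history n \<omega> = h) = \<P>(\<omega> in P. \<forall>k\<le>n. X k \<omega> = x k)"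
  proof (rule finite_measure_eq_AE)
    show "AE \<omega> in P. \<omega> \<in> {\<omega> \<in> space P. history n \<omega> = h} \<longleftrightarrow> \<omega> \<in> {\<omega> \<in> space P. \<forall>k\<le>n. X k \<omega> = x k}"
      using AE_path by eventually_elim blast
  qed simp_all
  have 2: "\<P>(\<omega> in P. history n \<omega> = h \<and> X (Suc n) \<omega> = X n \<omega> + 1)
      = \<P>(\<omega> in P. X (Suc n) \<omega> = X n \<omega> + 1 \<and> (\<forall>k\<le>n. X k \<omega> = x k))"
  proof (rule finite_measure_eq_AE)
    show "AE \<omega> in P. \<omega> \<in> {\<omega> \<in> space P. history n \<omega> = h \<and> X (Suc n) \<omega> = X n \<omega> + 1} \<longleftrightarrow> \<omega> \<in> {\<omega> \<in> space P. X (Suc n) \<omega> = X n \<omega> + 1 \<and> (\<forall>k\<le>n. X k \<omega> = x k)}"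
      using AE_path by eventually_elim blast
  qed simp_all
  have pos: "\<P>(\<omega> in P. \<forall>k\<le>n. X k \<omega> = x k) > 0"
    using False 1 by (simp add: zero_less_measure_iff)
  show ?thesis
    using later_right[OF assms pos] pos
    unfolding 1 2 right_prob_eq_jump_prob x cond_prob_def by (simp add: field_simps)
qed

text \<open>The martingale difference property, tested against an arbitrary function
  \<open>F\<close> of the past. Only finitely many histories of length \<open>n\<close> exist, so it
  follows by summing \<open>prob_history_and_right\<close> over them.\<close>

lemma expectation_jump_centered:
  assumes "N \<le> n"
  shows "expectation (\<lambda>\<omega>. F (history n \<omega>) *
    (of_bool (X (Suc n) \<omega> = X n \<omega> + 1) - jump_prob M p0 p1 (take N (history n \<omega>)))) = 0"
proof -
  let ?q = "\<lambda>h. jump_prob M p0 p1 (take N h)" and ?H = "{h :: bool list. length h = n}"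
  let ?R = "\<lambda>h. {\<omega> \<in> space P. history n \<omega> = h \<and> X (Suc n) \<omega> = X n \<omega> + 1}"
  let ?E = "\<lambda>h. {\<omega> \<in> space P. history n \<omega> = h}"
  have "F (history n \<omega>) * (of_bool (X (Suc n) \<omega> = X n \<omega> + 1) - ?q (history n \<omega>))
      = (\<Sum>h\<in>?H. F h * (indicator (?R h) \<omega> - ?q h * indicator (?E h) \<omega>))"
    if "\<omega> \<in> space P" for \<omega>
  proof -
    have "(\<Sum>h\<in>?H. F h * (indicator (?R h) \<omega> - ?q h * indicator (?E h) \<omega>))
        = (\<Sum>h\<in>?H. if h = history n \<omega>
            then F h * (of_bool (X (Suc n) \<omega> = X n \<omega> + 1) - ?q h) else 0)"
      using that by (intro sum.cong) (auto simp: indicator_def)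
    then show ?thesis by (simp add: finite_bool_lists)
  qed
  then have "expectation (\<lambda>\<omega>. F (history n \<omega>) *
      (of_bool (X (Suc n) \<omega> = X n \<omega> + 1) - ?q (history n \<omega>)))
    = expectation (\<lambda>\<omega>. \<Sum>h\<in>?H. F h * (indicator (?R h) \<omega> - ?q h * indicator (?E h) \<omega>))"
    by (intro Bochner_Integration.integral_cong) auto
  also have "\<dots> = (\<Sum>h\<in>?H. F h * (prob (?R h) - ?q h * prob (?E h)))"
  proof -
    have int: "integrable P (indicat_real A)" if "A \<in> events" for A
      using that by (simp add: less_top[symmetric])
    have [simp]: "integrable P (indicat_real (?R h))" "integrable P (indicat_real (?E h))" for h
      by (intro int; measurable)+
    show ?thesis by simp
  qed
  also have "\<dots> = 0"
    by (simp add: prob_history_and_right[OF assms])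
  finally show ?thesis .
qed

text \<open>Each increment is a function of the past times a centred jump indicator, and earlier
  increments belong to that past; so increments are uncorrelated and the strong law applies. Time
  starts at \<open>N\<close>, where the window is full and the threshold rule governs the next
  jump.\<close>

lemma AE_window_op_noise:
  fixes f :: "bool list \<Rightarrow> real"
  assumes p: "0 \<le> p0" "p0 \<le> p1" "p1 \<le> 1"
  shows "AE \<omega> in P. (\<lambda>n. (\<Sum>k<n. f (take N (history (N + Suc k) \<omega>))
    - window_op N M p0 p1 f (take N (history (N + k) \<omega>))) / real n) \<longlonglongrightarrow> 0"
proof -
  define D where "D k \<omega> = f (take N (history (N + Suc k) \<omega>))
    - window_op N M p0 p1 f (take N (history (N + k) \<omega>))" for k \<omega>
  define c where "c h = f (take N (True # h)) - f (take N (False # h))" for h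
  have D: "D k \<omega> = c (history (N + k) \<omega>) * (of_bool (X (Suc (N + k)) \<omega> = X (N + k) \<omega> + 1)
      - jump_prob M p0 p1 (take N (history (N + k) \<omega>)))" for k \<omega>
    by (simp add: D_def c_def jumps_Suc window_op_def take_Cons_take algebra_simps)
  have [measurable]: "(\<lambda>\<omega>. G (history n \<omega>)) \<in> borel_measurable P" for G :: "bool list \<Rightarrow> real" and n
    by (rule measurable_compose[OF measurable_history]) simp
  have meas: "D k \<in> borel_measurable P" for k
    unfolding D_def by measurable
  define b where "b = (\<Sum>w | length w = N. \<bar>f w\<bar>)"
  have f: "\<bar>f w\<bar> \<le> b" if "length w = N" for w
    unfolding b_def by (rule member_le_sum) (auto simp: that finite_bool_lists)
  have bound: "\<bar>D k \<omega>\<bar> \<le> 2 * b" for k \<omega>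
  proof -
    let ?w = "take N (history (N + k) \<omega>)"
    have q: "0 \<le> jump_prob M p0 p1 ?w" "jump_prob M p0 p1 ?w \<le> 1"
      using jump_prob_bounds[OF p(2), of M ?w] p by auto
    have "\<bar>f (take N (history (N + Suc k) \<omega>))\<bar> \<le> b"
      by (intro f) simp
    moreover have "\<bar>window_op N M p0 p1 f ?w\<bar> \<le> jump_prob M p0 p1 ?w * b + (1 - jump_prob M p0 p1 ?w) * b"
      unfolding window_op_def using q
      by (intro order_trans[OF abs_triangle_ineq] add_mono) (auto simp: abs_mult intro!: mult_left_mono f)
    ultimately show ?thesis by (simp add: D_def left_diff_distrib)
  qed
  have uncor: "expectation (\<lambda>\<omega>. D j \<omega> * D k \<omega>) = 0" if "j < k" for j k
  proof -
    \<comment> \<open>Dropping the newest jumps recovers the earlier histories at times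
      \<open>N + Suc j\<close> and \<open>N + j\<close>. Since \<open>j < k\<close>, both are part
      of the history at \<open>N + k\<close>.\<close>
    define F where "F h = (f (take N (drop (k - Suc j) h))
      - window_op N M p0 p1 f (take N (drop (k - j) h))) * c h" for h
    have "D j \<omega> * D k \<omega> = F (history (N + k) \<omega>) * (of_bool (X (Suc (N + k)) \<omega> = X (N + k) \<omega> + 1)
      - jump_prob M p0 p1 (take N (history (N + k) \<omega>)))" for \<omega>
      unfolding D[of k] using that jumps_eq_drop[of "N + Suc j" "N + k" "\<lambda>k. X k \<omega>"]
        jumps_eq_drop[of "N + j" "N + k" "\<lambda>k. X k \<omega>"]
      by (simp add: D_def F_def)
    then show ?thesis
      using expectation_jump_centered[of "N + k" F] by simp
  qed
  show ?thesis
    using AE_average_tendsto_zero[OF meas bound uncor] by (simp add: D_def)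
qed

lemma AE_speed:
  assumes M: "1 \<le> M" "M \<le> N" and p: "0 < p0" "p0 < p1" "p1 < 1"
  shows "AE \<omega> in P. (\<lambda>n. real_of_int (X n \<omega>) / real n) \<longlonglongrightarrow> speed_formula N M p0 p1"
proof -
  \<comment> \<open>The head of the window at time \<open>N + k\<close> is the step from time
    \<open>r + k\<close> to \<open>r + Suc k\<close>, hence the offset
    \<open>r = N - 1\<close>.\<close>
  obtain r where N: "N = Suc r" using M by (cases N) auto
  \<comment> \<open>The noise estimate is applied to every iterate of \<open>last_jump\<close>;
    countably many null sets are discarded.\<close>
  have "AE \<omega> in P. \<forall>j. (\<lambda>n. (\<Sum>k<n. (window_op N M p0 p1 ^^ j) last_jump (take N (history (N + Suc k) \<omega>))
      - (window_op N M p0 p1 ^^ Suc j) last_jump (take N (history (N + k) \<omega>))) / real n) \<longlonglongrightarrow> 0"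
    using p AE_window_op_noise by (simp add: AE_all_countable)
  then show ?thesis
    using AE_start_and_jumps
  proof (eventually_elim)
    case (elim \<omega>)
    let ?x = "\<lambda>n. real_of_int (X n \<omega>)" and ?s = "speed_formula N M p0 p1"
    have "(\<lambda>n. (\<Sum>k<n. last_jump (take N (history (N + k) \<omega>))) / real n)
        \<longlonglongrightarrow> stationary_mean N M p0 p1 last_jump"
      by (rule window_op_average_limit[where W = "\<lambda>k. take N (history (N + k) \<omega>)"])
         (use p M elim(1) in auto)
    moreover have "last_jump (take N (history (N + k) \<omega>)) = ?x (r + Suc k) - ?x (r + k)" for k
      using elim(2) by (auto simp: N jumps_Suc last_jump_def)
    ultimately have lim: "(\<lambda>n. (?x (r + n) - ?x r) / real n) \<longlonglongrightarrow> ?s"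
      using sum_lessThan_telescope[of "\<lambda>k. ?x (r + k)"] M
      by (simp add: stationary_mean_last_jump)
    \<comment> \<open>Restores the initial displacement \<open>?x r\<close> and changes the divisor
      from \<open>n\<close> to \<open>n + r\<close>; neither affects the limit.\<close>
    have "(\<lambda>n. (?x (r + n) - ?x r) / real n * (real n / real (n + r)) + ?x r / real (n + r)) \<longlonglongrightarrow> ?s * 1 + 0"
    proof (intro tendsto_add tendsto_mult lim)
      show "(\<lambda>n. real n / real (n + r)) \<longlonglongrightarrow> 1"
        by real_asymp
      show "(\<lambda>n. ?x r / real (n + r)) \<longlonglongrightarrow> 0"
        by (rule LIMSEQ_ignore_initial_segment[OF lim_const_over_n])
    qed
    moreover have "\<forall>\<^sub>F n in sequentially.
        (?x (r + n) - ?x r) / real n * (real n / real (n + r)) + ?x r / real (n + r)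
        = ?x (n + r) / real (n + r)"
      by (rule eventually_mono[OF eventually_gt_at_top[of 0]])
         (simp add: add.commute[of r] add_divide_distrib[symmetric])
    ultimately have "(\<lambda>n. ?x (n + r) / real (n + r)) \<longlonglongrightarrow> ?s"
      by (simp add: tendsto_cong)
    then show ?case by (rule LIMSEQ_offset)
  qed
qed

end

theorem theorem1:
  fixes P :: "'a measure" and N M :: nat and p0 p1 :: real
    and x0 :: int and X :: "nat \<Rightarrow> 'a \<Rightarrow> int"
  assumes "1 \<le> M" and "M \<le> N"
    and "0 < p0" and "p0 < p1" and "p1 < 1"
    and "recent_history_walk P N M p0 p1 x0 X"
  shows "AE \<omega> in P. (\<lambda>n. real_of_int (X n \<omega>) / real n) \<longlonglongrightarrow> speed_formula N M p0 p1"
  using recent_history_walk.AE_speed[OF assms(6) assms(1-5)] .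

end
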